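(* Let $A$ be a finite-dimensional perfect evolution $\mathbb{K}$-algebra with natural basis $B$, and let $I$ be an ideal of $A$. Then $I=I_{H_I}$ and $I$ has the absorption property.
   Context: An evolution algebra over a field $\mathbb{K}$ is a (not necessarily associative) $\mathbb{K}$-algebra $A$ having a basis $B=\{e_i\}_{i\in\Lambda}$, called a natural basis, with $e_ie_j=0$ whenever $i\neq j$. $A$ is perfect if $A^2=A$, where $A^2$ is the linear span of all products. An ideal $I$ of a commutative algebra $A$ has the absorption property if $xA\subset I$ implies $x\in I$. For an ideal $I$ of $A$, $H_I:=\{e_i\in B: e_i^2\in I\}$, and $I_{H_I}:=\operatorname{span}(H_I)$. *)

theory Defs
  imports Complex_Main
begin

text \<open>
  The field is a type of class \<^class>\<open>field\<close> and the algebra is a whole type, with scalar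
  multiplication and (not necessarily associative, commutative or unital) product as parameters.
\<close>

locale nonassoc_algebra = vector_space scale
  for scale :: "'k::field \<Rightarrow> 'a::ab_group_add \<Rightarrow> 'a" (infixr "*s" 75) +
  fixes mult :: "'a \<Rightarrow> 'a \<Rightarrow> 'a" (infixl "\<bullet>" 70)
  assumes mult_add_left: "(x + y) \<bullet> z = x \<bullet> z + y \<bullet> z"
    and mult_add_right: "x \<bullet> (y + z) = x \<bullet> y + x \<bullet> z"
    and mult_scale_left: "(c *s x) \<bullet> y = c *s (x \<bullet> y)"
    and mult_scale_right: "x \<bullet> (c *s y) = c *s (x \<bullet> y)"
begin

definition finite_dim :: bool where
  "finite_dim \<longleftrightarrow> (\<exists>S. finite S \<and> span S = UNIV)"

definition natural_basis :: "'a set \<Rightarrow> bool" where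
  "natural_basis B \<longleftrightarrow> independent B \<and> span B = UNIV \<and>
    (\<forall>e\<in>B. \<forall>f\<in>B. e \<noteq> f \<longrightarrow> e \<bullet> f = 0)"

definition perfect :: bool where
  "perfect \<longleftrightarrow> span {x \<bullet> y | x y. True} = UNIV"

definition ideal :: "'a set \<Rightarrow> bool" where
  "ideal I \<longleftrightarrow> subspace I \<and> (\<forall>x\<in>I. \<forall>a. x \<bullet> a \<in> I \<and> a \<bullet> x \<in> I)"

text \<open>Only the product on one side is mentioned, as for commutative algebras; every algebra with
  a natural basis is commutative.\<close>

definition absorption_property :: "'a set \<Rightarrow> bool" where
  "absorption_property I \<longleftrightarrow> (\<forall>x. {x \<bullet> a | a. True} \<subseteq> I \<longrightarrow> x \<in> I)"

definition H :: "'a set \<Rightarrow> 'a set \<Rightarrow> 'a set" where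
  "H B I = {e \<in> B. e \<bullet> e \<in> I}"

end

locale evolution_algebra = nonassoc_algebra +
  assumes ex_natural_basis: "\<exists>B. natural_basis B"

end

theory Submission
  imports Defs
begin

text \<open>
  Multiplication by a basis vector isolates a coordinate: if \<open>x = \<Sum>b\<in>B. u b *s b\<close>, then
  \<open>x \<bullet> e = u e *s (e \<bullet> e)\<close> for \<open>e \<in> B\<close>. So if \<open>x\<close> multiplies the algebra into a subspace \<open>I\<close>,
  every \<open>e\<close> with a nonzero coordinate in \<open>x\<close> has its square in \<open>I\<close>, which puts \<open>x\<close> in the span of
  \<open>H B I\<close>. This applies to every element of an ideal, so \<open>I \<subseteq> span (H B I)\<close>, and it
  reduces the absorption property to the reverse inclusion.

  The reverse inclusion is a dimension count. The squares of the basis vectors span the span of all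
  products, so in a perfect algebra they span everything; being at most \<open>card B\<close> many, they are
  pairwise distinct and independent. The squares of the elements of \<open>H B I\<close> are thus
  \<open>card (H B I)\<close> many independent vectors, and they lie in \<open>I \<subseteq> span (H B I)\<close>, a space whose
  dimension is that same number. So they already span \<open>span (H B I)\<close>, and \<open>I\<close> contains their span.
\<close>

context nonassoc_algebra
begin

lemma mult_zero_right: "x \<bullet> 0 = 0"
  using mult_add_right[of x 0 0] by simp

lemma mult_zero_left: "0 \<bullet> x = 0"
  using mult_add_left[of 0 0 x] by simp

lemma mult_sum_left: "(\<Sum>b\<in>S. f b) \<bullet> y = (\<Sum>b\<in>S. f b \<bullet> y)"
  by (induction S rule: infinite_finite_induct) (auto simp: mult_zero_left mult_add_left)

lemma finite_natural_basis:
  assumes "finite_dim" and "natural_basis B"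
  shows "finite B"
  using assms independent_span_bound unfolding finite_dim_def natural_basis_def by blast

lemma mult_basis_vector:
  assumes "natural_basis B" and "finite B" and "e \<in> B"
  shows "(\<Sum>b\<in>B. u b *s b) \<bullet> e = u e *s (e \<bullet> e)"
proof -
  have "(\<Sum>b\<in>B. u b *s b) \<bullet> e = (\<Sum>b\<in>B. u b *s (b \<bullet> e))"
    by (simp add: mult_sum_left mult_scale_left)
  also have "\<dots> = (\<Sum>b\<in>B. if b = e then u e *s (e \<bullet> e) else 0)"
    using assms(1,3) by (intro sum.cong) (auto simp: natural_basis_def)
  also have "\<dots> = u e *s (e \<bullet> e)"
    using assms(2,3) by simp
  finally show ?thesis .
qed

lemma natural_basis_expansion:
  assumes "natural_basis B" and "finite B"
  obtains u where "x = (\<Sum>b\<in>B. u b *s b)"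
  using assms span_finite[of B] unfolding natural_basis_def by blast

lemma mult_in_span_basis_squares:
  assumes "natural_basis B" and "finite B"
  shows "x \<bullet> y \<in> span ((\<lambda>e. e \<bullet> e) ` B)"
proof -
  let ?Q = "span ((\<lambda>e. e \<bullet> e) ` B)"
  have "x \<bullet> e \<in> ?Q" if "e \<in> B" for e
  proof -
    obtain u where "x = (\<Sum>b\<in>B. u b *s b)"
      using natural_basis_expansion[OF assms] .
    then have "x \<bullet> e = u e *s (e \<bullet> e)"
      using mult_basis_vector[OF assms that] by simp
    then show ?thesis
      using that by (simp add: span_scale span_base)
  qed
  then have "B \<subseteq> {y. x \<bullet> y \<in> ?Q}" by blast
  moreover have "subspace {y. x \<bullet> y \<in> ?Q}"
    by (rule subspaceI) (auto simp: mult_zero_right mult_add_right mult_scale_right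
        span_zero span_add span_scale)
  ultimately have "span B \<subseteq> {y. x \<bullet> y \<in> ?Q}"
    by (rule span_minimal)
  then show ?thesis
    using assms(1) by (auto simp: natural_basis_def)
qed

text \<open>Perfectness makes the squares a spanning family of at most \<open>card B\<close> elements. A coincidence or a
  linear relation among them would leave fewer than \<open>card B\<close> vectors spanning the algebra.\<close>

lemma basis_squares_independent:
  assumes "natural_basis B" and "finite B" and "perfect"
  shows "inj_on (\<lambda>e. e \<bullet> e) B" and "independent ((\<lambda>e. e \<bullet> e) ` B)"
proof -
  let ?Q = "(\<lambda>e. e \<bullet> e) ` B"
  interpret finite_dimensional_vector_space scale B
    using assms(1,2) by unfold_locales (auto simp: natural_basis_def)
  have "span {x \<bullet> y | x y. True} \<subseteq> span ?Q"
    using mult_in_span_basis_squares[OF assms(1,2)] by (intro span_minimal) auto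
  then have spanning: "UNIV \<subseteq> span ?Q"
    using assms(3) by (simp add: perfect_def)
  have "card ?Q \<le> card B"
    using assms(2) by (rule card_image_le)
  moreover have "card B \<le> card ?Q"
    using dim_le_card[OF spanning] assms(2) by simp
  ultimately have "card ?Q = card B" by simp
  with assms(2) show "inj_on (\<lambda>e. e \<bullet> e) B"
    by (rule eq_card_imp_inj_on)
  show "independent ?Q"
    using \<open>card ?Q \<le> card B\<close> spanning assms(2)
    by (intro card_le_dim_spanning[of ?Q UNIV]) auto
qed

text \<open>Both the inclusion of an ideal in \<open>span (H B I)\<close> and the absorption property come from
  this. A nonzero coordinate of \<open>x\<close> can be divided out of \<open>x \<bullet> e = u e *s (e \<bullet> e)\<close>, leaving
  \<open>e \<bullet> e \<in> I\<close>; so the coordinates of \<open>x\<close> outside \<open>H B I\<close> vanish.\<close>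

lemma absorbed_in_span_H:
  assumes "natural_basis B" and "finite B" and "subspace I" and absorbed: "\<And>a. x \<bullet> a \<in> I"
  shows "x \<in> span (H B I)"
proof -
  obtain u where x: "x = (\<Sum>b\<in>B. u b *s b)"
    using natural_basis_expansion[OF assms(1,2)] .
  have "u e *s e \<in> span (H B I)" if "e \<in> B" for e
  proof (cases "u e = 0")
    case True
    then show ?thesis by (simp add: span_zero)
  next
    case False
    have "u e *s (e \<bullet> e) \<in> I"
      using absorbed[of e] mult_basis_vector[OF assms(1,2) that] x by simp
    then have "inverse (u e) *s u e *s (e \<bullet> e) \<in> I"
      using assms(3) by (rule subspace_scale[rotated])
    then have "e \<in> H B I"
      using False that by (simp add: H_def)
    then show ?thesis
      by (simp add: span_scale span_base)
  qed
  then show ?thesis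
    unfolding x by (rule span_sum)
qed

lemma span_H_eq_ideal:
  assumes "natural_basis B" and "finite B" and "perfect" and "ideal I"
  shows "span (H B I) = I"
proof
  interpret finite_dimensional_vector_space scale B
    using assms(1,2) by unfold_locales (auto simp: natural_basis_def)
  let ?S = "(\<lambda>e. e \<bullet> e) ` H B I"
  have "subspace I" and absorbed: "\<And>x a. x \<in> I \<Longrightarrow> x \<bullet> a \<in> I"
    using assms(4) by (auto simp: ideal_def)
  show le: "I \<subseteq> span (H B I)"
    using absorbed_in_span_H[OF assms(1,2) \<open>subspace I\<close>] absorbed by blast
  have "H B I \<subseteq> B" and "?S \<subseteq> I"
    by (auto simp: H_def)
  have "independent ?S"
    using basis_squares_independent(2)[OF assms(1-3)] \<open>H B I \<subseteq> B\<close>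
    by (rule independent_mono[OF _ image_mono])
  moreover have "card ?S = card (H B I)"
    using basis_squares_independent(1)[OF assms(1-3)] \<open>H B I \<subseteq> B\<close>
    by (intro card_image) (rule inj_on_subset)
  moreover have "dim (span (H B I)) = card (H B I)"
    using independent_Basis \<open>H B I \<subseteq> B\<close>
    by (intro dim_span_eq_card_independent) (rule independent_mono)
  ultimately have "span (H B I) \<subseteq> span ?S"
    using \<open>?S \<subseteq> I\<close> le by (intro card_ge_dim_independent[of ?S "span (H B I)"]) auto
  also have "\<dots> \<subseteq> I"
    using \<open>?S \<subseteq> I\<close> \<open>subspace I\<close> by (rule span_minimal)
  finally show "span (H B I) \<subseteq> I" .
qed

end

theorem theorem5p8:
  fixes scale :: "'k::field \<Rightarrow> 'a::ab_group_add \<Rightarrow> 'a"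
    and mult :: "'a \<Rightarrow> 'a \<Rightarrow> 'a"
    and B I :: "'a set"
  assumes "evolution_algebra scale mult"
    and "nonassoc_algebra.finite_dim scale"
    and "nonassoc_algebra.perfect scale mult"
    and "nonassoc_algebra.natural_basis scale mult B"
    and "nonassoc_algebra.ideal scale mult I"
  shows "I = module.span scale (nonassoc_algebra.H mult B I)
    \<and> nonassoc_algebra.absorption_property mult I"
proof -
  interpret evolution_algebra scale mult by fact
  have "finite B"
    using assms(2,4) by (rule finite_natural_basis)
  then have eq: "span (H B I) = I"
    using assms(3-5) span_H_eq_ideal by blast
  have "subspace I"
    using assms(5) by (simp add: ideal_def)
  have "absorption_property I"
    unfolding absorption_property_def
    using absorbed_in_span_H[OF assms(4) \<open>finite B\<close> \<open>subspace I\<close>] eq by blast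
  with eq show ?thesis by simp
qed

end
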